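(* Let $\mu$ be a probability measure on $\mathbb{R}$ which has a finite absolute third moment $$\beta:=\int_{\mathbb{R}}|x|^3\,d\mu(x)<\infty.$$ Then $\mu * C_t$ is unimodal for $t\ge 20\,\beta^{1/3}$.
   Context: A Borel measure $\mu$ on $\mathbb{R}$ is unimodal if there exist $a\in\mathbb{R}$ and a function $f\colon\mathbb{R}\to[0,\infty)$, non-decreasing on $(-\infty,a)$ and non-increasing on $(a,\infty)$, such that $\mu(dx)=\mu(\{a\})\delta_a+f(x)\,dx$. For $t>0$, $C_t$ is the symmetric Cauchy distribution $C_t(dx)=\frac{t}{\pi(x^2+t^2)}\,dx$ on $\mathbb{R}$, and $C_0=\delta_0$. Here $*$ is the classical convolution of probability measures on $\mathbb{R}$. *)

theory Defs
  imports "HOL-Probability.Probability"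
begin

text \<open>
  The mass at \<open>a\<close> may be infinite, so the decomposition is stated in \<^typ>\<open>ennreal\<close>.
  Measurability of \<open>f\<close> is not required separately: it follows from monotonicity on both sides
  of \<open>a\<close>.  The value \<open>f a\<close> is only constrained to be nonnegative.
\<close>

definition unimodal :: "real measure \<Rightarrow> bool" where
  "unimodal M \<longleftrightarrow>
     sets M = sets borel \<and>
     (\<exists>(a::real) (f::real \<Rightarrow> real).
        (\<forall>x. 0 \<le> f x) \<and>
        mono_on {..<a} f \<and>
        antimono_on {a<..} f \<and>
        (\<forall>A\<in>sets borel. emeasure M A =
           emeasure M {a} * emeasure (return borel a) A + (\<integral>\<^sup>+x\<in>A. ennreal (f x) \<partial>lborel)))"

text \<open>Only meaningful for \<open>t \<ge> 0\<close>; for \<open>t < 0\<close> this is the zero measure.\<close>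

definition cauchy_distribution :: "real \<Rightarrow> real measure" where
  "cauchy_distribution t =
     (if t = 0 then return borel 0
      else density lborel (\<lambda>x. ennreal (t / (pi * (x\<^sup>2 + t\<^sup>2)))))"

end

theory Submission
  imports Defs
begin

text \<open>
  After rescaling to \<open>t = 1\<close>, the density of \<open>\<mu> \<star> C\<^sub>1\<close> is a constant multiple of
  \<open>G u = E (1 / (1 + (u - Z)\<^sup>2))\<close> with \<open>E \<bar>Z\<bar>\<^sup>3 \<le> 1/8000\<close>.  The first two derivatives of the
  kernel at \<open>u - z\<close> are bounded by affine functions of \<open>\<bar>z\<bar>\<^sup>3\<close>: when \<open>z\<close> is small the kernel is
  close to its unperturbed version, and when \<open>z\<close> is large the cubic term dominates.  Taking
  expectations, \<open>G\<close> is concave on \<open>[-1/4, 1/4]\<close> and monotone on either side of that interval, so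
  a zero of \<open>G'\<close> in the interval is a mode.
\<close>

section \<open>Differentiation under the expectation\<close>

text \<open>By the mean value inequality every difference quotient of \<open>F\<close> is bounded by
  \<open>B'\<close>, a constant and so integrable over a finite measure. Dominated convergence along
  sequences tending to 0 then moves the limit inside; \<open>B\<close> ensures that the integrals of
  \<open>F\<close> exist.\<close>

lemma (in finite_measure) has_field_derivative_integral_translate:
  fixes F F' :: "real \<Rightarrow> real" and Z :: "'a \<Rightarrow> real"
  assumes Z[measurable]: "Z \<in> borel_measurable M"
    and deriv: "\<And>w. (F has_field_derivative F' w) (at w)"
    and cont: "continuous_on UNIV F'"
    and bound: "\<And>w. \<bar>F w\<bar> \<le> B" and bound': "\<And>w. \<bar>F' w\<bar> \<le> B'"
  shows "((\<lambda>u. \<integral>x. F (u - Z x) \<partial>M) has_field_derivative (\<integral>x. F' (u - Z x) \<partial>M)) (at u)"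
proof -
  have "continuous_on UNIV F"
    using DERIV_isCont[OF deriv] by (simp add: continuous_on_eq_continuous_at)
  with cont have [measurable]: "F \<in> borel_measurable borel" "F' \<in> borel_measurable borel"
    by (auto intro: borel_measurable_continuous_onI)
  have int: "integrable M (\<lambda>x. F (v - Z x))" for v
    using bound by (intro integrable_const_bound[where B = B]) auto
  have lip: "\<bar>F b - F a\<bar> \<le> B' * \<bar>b - a\<bar>" for a b
    using field_differentiable_bound[of UNIV F F' B' b a] deriv bound' by auto
  have "((\<lambda>h. ((\<integral>x. F (u + h - Z x) \<partial>M) - (\<integral>x. F (u - Z x) \<partial>M)) / h)
      \<longlongrightarrow> (\<integral>x. F' (u - Z x) \<partial>M)) (at 0)"
    unfolding tendsto_at_iff_sequentially
  proof (intro allI impI)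
    fix X :: "nat \<Rightarrow> real"
    assume X0: "\<forall>i. X i \<in> UNIV - {0}" and X: "X \<longlonglongrightarrow> 0"
    have "(\<lambda>n. \<integral>x. (F (u + X n - Z x) - F (u - Z x)) / X n \<partial>M) \<longlonglongrightarrow> (\<integral>x. F' (u - Z x) \<partial>M)"
    proof (rule integral_dominated_convergence[where w = "\<lambda>_. B'"])
      show "AE x in M. (\<lambda>n. (F (u + X n - Z x) - F (u - Z x)) / X n) \<longlonglongrightarrow> F' (u - Z x)"
      proof (rule AE_I2)
        fix x
        have "((\<lambda>h. (F (u - Z x + h) - F (u - Z x)) / h) \<longlongrightarrow> F' (u - Z x)) (at 0)"
          using deriv by (simp add: DERIV_def)
        then show "(\<lambda>n. (F (u + X n - Z x) - F (u - Z x)) / X n) \<longlonglongrightarrow> F' (u - Z x)"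
          using X0 X unfolding tendsto_at_iff_sequentially comp_def
          by (auto simp: algebra_simps)
      qed
      show "AE x in M. norm ((F (u + X n - Z x) - F (u - Z x)) / X n) \<le> B'" for n
      proof (rule AE_I2)
        fix x
        show "norm ((F (u + X n - Z x) - F (u - Z x)) / X n) \<le> B'"
          using lip[of "u + X n - Z x" "u - Z x"] X0 by (simp add: field_simps)
      qed
    qed auto
    then show "((\<lambda>h. ((\<integral>x. F (u + h - Z x) \<partial>M) - (\<integral>x. F (u - Z x) \<partial>M)) / h) \<circ> X)
        \<longlonglongrightarrow> (\<integral>x. F' (u - Z x) \<partial>M)"
      using int by (simp add: comp_def)
  qed
  then show ?thesis
    by (simp add: DERIV_def)
qed

section \<open>The Cauchy kernel, its derivatives and their global bounds\<close>

text \<open>This is pi times the density of C_1.\<close>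

definition kern :: "real \<Rightarrow> real" where "kern w = 1 / (1 + w\<^sup>2)"

definition kern' :: "real \<Rightarrow> real" where "kern' w = - 2 * w / (1 + w\<^sup>2)\<^sup>2"

definition kern'' :: "real \<Rightarrow> real" where "kern'' w = (6 * w\<^sup>2 - 2) / (1 + w\<^sup>2) ^ 3"

lemma one_plus_square_neq_0 [simp]: "1 + (w::real)\<^sup>2 \<noteq> 0"
  by (smt (verit) zero_le_power2)

lemma kern_deriv: "(kern has_field_derivative kern' w) (at w)"
  unfolding kern_def kern'_def
  by (rule derivative_eq_intros refl | simp)+ (simp add: power2_eq_square)

lemma kern'_deriv: "(kern' has_field_derivative kern'' w) (at w)"
  unfolding kern'_def
  by (rule derivative_eq_intros refl | simp)+
    (simp add: kern''_def divide_simps, simp add: algebra_simps power_numeral_reduce)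

lemma continuous_kern: "continuous_on UNIV kern" "continuous_on UNIV kern'" "continuous_on UNIV kern''"
  unfolding kern_def kern'_def kern''_def by (auto intro!: continuous_intros)

lemma kern_nonneg: "0 \<le> kern w"
  by (simp add: kern_def)

lemma kern'_minus: "kern' (- w) = - kern' w"
  by (simp add: kern'_def)

lemma abs_kern_le_1: "\<bar>kern w\<bar> \<le> 1"
  by (simp add: kern_def divide_le_eq add_pos_nonneg)

lemma abs_kern'_le_1: "\<bar>kern' w\<bar> \<le> 1"
proof -
  have "2 * \<bar>w\<bar> \<le> 1 + w\<^sup>2"
    using zero_le_power2[of "\<bar>w\<bar> - 1"] by (simp add: power2_eq_square algebra_simps)
  also have "\<dots> \<le> (1 + w\<^sup>2)\<^sup>2"
    by (rule self_le_power) auto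
  finally show ?thesis
    by (simp add: kern'_def abs_mult)
qed

text \<open>The maximum of \<open>kern''\<close> is attained at w^2 = 1, whence the double factor
  (w^2 - 1)^2 in the difference of the two sides after clearing denominators.\<close>

lemma kern''_le_half: "kern'' w \<le> 1/2"
proof -
  have "0 \<le> (w\<^sup>2 - 1)\<^sup>2 * (w\<^sup>2 + 5)"
    by simp
  also have "(w\<^sup>2 - 1)\<^sup>2 * (w\<^sup>2 + 5) = (1 + w\<^sup>2) ^ 3 - 2 * (6 * w\<^sup>2 - 2)"
    by (simp add: algebra_simps power_numeral_reduce)
  finally show ?thesis
    by (simp add: kern''_def divide_le_eq add_pos_nonneg)
qed

lemma abs_kern''_le_2: "\<bar>kern'' w\<bar> \<le> 2"
proof -
  have "1 \<le> (1 + w\<^sup>2) ^ 3"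
    by (rule one_le_power) simp
  then have "- 2 * (1 + w\<^sup>2) ^ 3 \<le> 6 * w\<^sup>2 - 2"
    using zero_le_power2[of w] by linarith
  then have "- 2 \<le> kern'' w"
    by (simp add: kern''_def le_divide_eq add_pos_nonneg)
  with kern''_le_half[of w] show ?thesis
    by linarith
qed

section \<open>Bounds on the translated derivatives, affine in the cube of |z|\<close>

text \<open>For |z| <= 1/4 the argument stays in [-1/2, 1/2], where \<open>kern''\<close> is at most
  -1/4. For larger z, 48 |z|^3 >= 48/64 = 3/4 lifts the right side to at least 1/2, the maximum of
  \<open>kern''\<close>; this fixes the constant 48.\<close>

lemma kern''_translate_le:
  assumes "\<bar>u\<bar> \<le> 1/4"
  shows "kern'' (u - z) \<le> - 1/4 + 48 * \<bar>z\<bar> ^ 3"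
proof (cases "\<bar>z\<bar> \<le> 1/4")
  case True
  define s where "s = (u - z)\<^sup>2"
  have "\<bar>u - z\<bar> \<le> 1/2"
    using True assms by linarith
  then have "s \<le> (1/2)\<^sup>2"
    unfolding s_def by (rule power2_le_iff_abs_le[THEN iffD2, rotated]) simp
  then have s: "0 \<le> s" "s \<le> 1/4"
    by (auto simp: s_def power2_eq_square)
  have "(1 + s) ^ 3 \<le> (1 + 1/4) ^ 3"
    using s by (intro power_mono) auto
  \<comment> \<open>The right side is -4 times the numerator 6 s - 2, so this is
    \<open>kern''\<close> <= -1/4 with the denominator cleared. It holds since 125/64 < 2 <= 8 - 24
    s.\<close>
  also have "\<dots> \<le> 8 - 24 * s"
    using s by (simp add: power3_eq_cube)
  finally have "kern'' (u - z) \<le> - 1/4"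
    using s by (simp add: kern''_def flip: s_def) (simp add: divide_le_eq)
  then show ?thesis
    by (smt (verit) zero_le_power)
next
  case False
  then have "(1/4) ^ 3 \<le> \<bar>z\<bar> ^ 3"
    by (intro power_mono) auto
  with kern''_le_half[of "u - z"] show ?thesis
    by (simp add: power3_eq_cube)
qed

text \<open>The split is at |z| = u/2. Below it, u - z lies in [u/2, 3u/2], so -\<open>kern'\<close>
  has numerator at least u and denominator at most that of \<open>c\<close>. Above it, 8 |z|^3 / u^3
  >= 1, so the right side is at least -c + (1 + c) = 1, which bounds \<open>kern'\<close>
  everywhere.\<close>

lemma kern'_translate_le:
  assumes "1/4 \<le> u"
  defines "c \<equiv> u / (1 + 9/4 * u\<^sup>2)\<^sup>2"
  shows "kern' (u - z) \<le> - c + (1 + c) * 8 / u ^ 3 * \<bar>z\<bar> ^ 3"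
proof (cases "\<bar>z\<bar> \<le> u / 2")
  case True
  then have w: "u / 2 \<le> u - z" "u - z \<le> 3/2 * u"
    by auto
  have "(u - z)\<^sup>2 \<le> (3/2 * u)\<^sup>2"
    using w assms by (intro power_mono) auto
  then have "(1 + (u - z)\<^sup>2)\<^sup>2 \<le> (1 + 9/4 * u\<^sup>2)\<^sup>2"
    by (intro power_mono) (auto simp: power2_eq_square)
  moreover have "0 < (1 + (u - z)\<^sup>2)\<^sup>2"
    by (simp add: add_pos_nonneg)
  ultimately have "c \<le> 2 * (u - z) / (1 + (u - z)\<^sup>2)\<^sup>2"
    unfolding c_def using w assms by (intro frac_le) auto
  moreover have "0 \<le> (1 + c) * 8 / u ^ 3 * \<bar>z\<bar> ^ 3"
    using assms by (simp add: c_def)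
  moreover have "kern' (u - z) = - (2 * (u - z) / (1 + (u - z)\<^sup>2)\<^sup>2)"
    by (simp add: kern'_def minus_divide_left)
  ultimately show ?thesis
    by linarith
next
  case False
  then have "(u / 2) ^ 3 \<le> \<bar>z\<bar> ^ 3"
    using assms by (intro power_mono) auto
  then have *: "1 \<le> 8 / u ^ 3 * \<bar>z\<bar> ^ 3"
    using assms by (simp add: field_simps power3_eq_cube)
  define m where "m = 8 / u ^ 3 * \<bar>z\<bar> ^ 3"
  from * have "1 \<le> m"
    by (simp add: m_def)
  moreover have "0 \<le> c"
    using assms by (simp add: c_def)
  ultimately have "1 + c \<le> (1 + c) * m"
    by (simp add: mult_le_cancel_left1)
  also have "\<dots> = (1 + c) * 8 / u ^ 3 * \<bar>z\<bar> ^ 3"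
    by (simp add: m_def)
  finally show ?thesis
    using abs_le_D1[OF abs_kern'_le_1[of "u - z"]] by argo
qed

text \<open>With third moment at most 1/8000, this makes the expectation of the bound in
  \<open>kern'_translate_le\<close> nonpositive. Cleared of denominators it reads 1 + c <= 1000 u^3
  c, which follows from c <= 1 and 2 <= 1000 u^3 c.\<close>

lemma moment_coefficient_le:
  fixes u :: real
  assumes "1/4 \<le> u"
  defines "c \<equiv> u / (1 + 9/4 * u\<^sup>2)\<^sup>2"
  shows "(1 + c) * 8 / u ^ 3 * (1/8000) \<le> c"
proof -
  define D where "D = 1 + 9/4 * u\<^sup>2"
  have D1: "1 \<le> D"
    by (simp add: D_def)
  have "(1/4)\<^sup>2 \<le> u\<^sup>2"
    using assms by (intro power_mono) auto
  \<comment> \<open>Since 1 <= 16 u^2, even 16 + 9/4 would do as coefficient; 22 is an integer above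
    it whose square, 484, is still below 500.\<close>
  then have "D \<le> 22 * u\<^sup>2"
    by (simp add: D_def power2_eq_square)
  then have "D\<^sup>2 \<le> (22 * u\<^sup>2)\<^sup>2"
    using D1 by (intro power_mono) auto
  also have "\<dots> \<le> 500 * u ^ 4"
    by (simp add: power_mult_distrib)
  finally have "2 \<le> 1000 * u ^ 4 / D\<^sup>2"
    using D1 by (simp add: le_divide_eq)
  also have "1000 * u ^ 4 / D\<^sup>2 = c * (1000 * u ^ 3)"
    by (simp add: c_def D_def power_numeral_reduce)
  finally have 2: "2 \<le> c * (1000 * u ^ 3)" .
  have "u \<le> u\<^sup>2 + 1/4"
    using zero_le_power2[of "u - 1/2"] unfolding power2_diff by (simp add: power_divide)
  also have "\<dots> \<le> D"
    unfolding D_def using zero_le_power2[of u] by linarith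
  also have "\<dots> \<le> D\<^sup>2"
    using D1 by (rule self_le_power) auto
  finally have "c \<le> 1"
    unfolding c_def D_def[symmetric] using D1 by (simp add: divide_le_eq)
  with 2 have "1 + c \<le> c * (1000 * u ^ 3)"
    by linarith
  then show ?thesis
    using assms(1) by (simp add: field_simps)
qed

section \<open>Unimodality at scale one\<close>

lemma (in prob_space) expectation_kern_unimodal:
  fixes Z :: "'a \<Rightarrow> real"
  assumes Z[measurable]: "random_variable borel Z"
    and int3: "integrable M (\<lambda>x. \<bar>Z x\<bar> ^ 3)"
    and moment: "expectation (\<lambda>x. \<bar>Z x\<bar> ^ 3) \<le> 1/8000"
  defines "G \<equiv> \<lambda>u. expectation (\<lambda>x. kern (u - Z x))"
  obtains a where "mono_on {..a} G" "antimono_on {a..} G"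
proof -
  define G' where "G' u = expectation (\<lambda>x. kern' (u - Z x))" for u
  define G'' where "G'' u = expectation (\<lambda>x. kern'' (u - Z x))" for u
  have dG: "(G has_field_derivative G' u) (at u)" for u
    unfolding G_def G'_def
    by (rule has_field_derivative_integral_translate
        [OF Z kern_deriv continuous_kern(2) abs_kern_le_1 abs_kern'_le_1])
  have dG': "(G' has_field_derivative G'' u) (at u)" for u
    unfolding G'_def G''_def
    by (rule has_field_derivative_integral_translate
        [OF Z kern'_deriv continuous_kern(3) abs_kern'_le_1 abs_kern''_le_2])
  have [measurable]: "kern' \<in> borel_measurable borel" "kern'' \<in> borel_measurable borel"
    by (intro borel_measurable_continuous_onI continuous_kern)+
  have int': "integrable M (\<lambda>x. kern' (u - Z x))" for u
    using abs_kern'_le_1 by (intro integrable_const_bound[where B = 1]) auto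
  have int'': "integrable M (\<lambda>x. kern'' (u - Z x))" for u
    using abs_kern''_le_2 by (intro integrable_const_bound[where B = 2]) auto
  have affine: "integrable M (\<lambda>x. p + q * \<bar>Z x\<bar> ^ 3)"
    "expectation (\<lambda>x. p + q * \<bar>Z x\<bar> ^ 3) = p + q * expectation (\<lambda>x. \<bar>Z x\<bar> ^ 3)" for p q
    using int3 by (auto simp: prob_space)
  \<comment> \<open>The bound has expectation at most -1/4 + 48/8000 < 0.\<close>
  have concave: "G'' u \<le> 0" if "\<bar>u\<bar> \<le> 1/4" for u
  proof -
    have "G'' u \<le> - 1/4 + 48 * expectation (\<lambda>x. \<bar>Z x\<bar> ^ 3)"
      unfolding G''_def affine(2)[symmetric]
      using kern''_translate_le[OF that] by (intro integral_mono int'' affine(1)) auto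
    with moment show ?thesis
      by linarith
  qed
  \<comment> \<open>Only |z| enters the estimate, so it is stated for any \<open>z\<close> with the
    absolute value of \<open>Z\<close>: the right tail takes \<open>Z\<close>, the left tail takes
    its negative.\<close>
  have tail: "expectation (\<lambda>x. kern' (u - z x)) \<le> 0"
    if u: "1/4 \<le> u" and z: "\<And>x. \<bar>z x\<bar> = \<bar>Z x\<bar>"
      and int: "integrable M (\<lambda>x. kern' (u - z x))" for u z
  proof -
    define c where "c = u / (1 + 9/4 * u\<^sup>2)\<^sup>2"
    have "expectation (\<lambda>x. kern' (u - z x))
        \<le> - c + (1 + c) * 8 / u ^ 3 * expectation (\<lambda>x. \<bar>Z x\<bar> ^ 3)"
      unfolding affine(2)[symmetric] c_def
      using kern'_translate_le[OF u, of "z _"] by (intro integral_mono int affine(1)) (auto simp: z)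
    also have "\<dots> \<le> - c + (1 + c) * 8 / u ^ 3 * (1/8000)"
      using u moment by (intro add_left_mono mult_left_mono) (auto simp: c_def)
    also have "\<dots> \<le> 0"
      using moment_coefficient_le[OF u] by (simp add: c_def)
    finally show ?thesis .
  qed
  have right: "G' u \<le> 0" if "1/4 \<le> u" for u
    unfolding G'_def using that int' by (intro tail) auto
  have left: "0 \<le> G' u" if "u \<le> - 1/4" for u
  proof -
    \<comment> \<open>Reflection turns the left tail at \<open>u\<close> into the right tail at
      \<open>- u\<close> for the variable -Z.\<close>
    have odd: "kern' (- u - (- Z x)) = - kern' (u - Z x)" for x
      using kern'_minus[of "u - Z x"] by simp
    have "expectation (\<lambda>x. kern' (- u - (- Z x))) \<le> 0"
      using that int'[of u] by (intro tail) (auto simp only: odd abs_minus_cancel integrable_minus)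
    then show ?thesis
      unfolding odd G'_def by simp
  qed
  have anti: "G' v \<le> G' u" if "- 1/4 \<le> u" "u \<le> v" "v \<le> 1/4" for u v
    using that by (intro DERIV_nonpos_imp_nonincreasing[of u v G']) (auto intro!: exI dG' concave)
  have "\<exists>a\<ge>- 1/4. a \<le> 1/4 \<and> G' a = 0"
    using right[of "1/4"] left[of "- 1/4"] dG'
    by (intro IVT2) (auto intro: DERIV_isCont)
  then obtain a where a: "- 1/4 \<le> a" "a \<le> 1/4" "G' a = 0"
    by auto
  \<comment> \<open>Either u <= -1/4 and the tail estimate applies, or u lies in [-1/4, a], where G'
    decreases to its zero at \<open>a\<close>; \<open>neg\<close> is symmetric.\<close>
  have pos: "0 \<le> G' u" if "u \<le> a" for u
    using left[of u] anti[of u a] a that by force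
  have neg: "G' u \<le> 0" if "a \<le> u" for u
    using right[of u] anti[of a u] a that by force
  show thesis
  proof
    show "mono_on {..a} G"
      by (intro mono_onI DERIV_nonneg_imp_nondecreasing[of _ _ G]) (auto intro!: exI dG pos)
    show "antimono_on {a..} G"
      by (intro monotone_onI DERIV_nonpos_imp_nonincreasing[of _ _ G]) (auto intro!: exI dG neg)
  qed
qed

section \<open>Convolutions, densities and point masses\<close>

text \<open>Tonelli, after translating the inner integral by \<open>y\<close>. Finiteness of
  \<open>c\<close> makes the second factor sigma-finite, as the product measure requires.\<close>

lemma convolution_density_lborel:
  fixes M :: "real measure" and c :: "real \<Rightarrow> ennreal"
  assumes M: "finite_measure M" and sets[measurable_cong]: "sets M = sets borel"
    and c[measurable]: "c \<in> borel_measurable borel" and finite: "\<And>x. c x \<noteq> \<infinity>"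
  shows "M \<star> density lborel c = density lborel (\<lambda>x. \<integral>\<^sup>+y. c (x - y) \<partial>M)"
proof (rule measure_eqI)
  interpret M: finite_measure M by fact
  interpret N: sigma_finite_measure "density lborel c"
    using finite by (subst sigma_finite_measure.sigma_finite_iff_density_finite[OF sigma_finite_lborel]) auto
  interpret P: pair_sigma_finite lborel M ..
  fix A assume "A \<in> sets (M \<star> density lborel c)"
  then have A[measurable]: "A \<in> sets borel"
    by simp
  have "emeasure (M \<star> density lborel c) A
      = (\<integral>\<^sup>+p. indicator A (fst p + snd p) \<partial>(M \<Otimes>\<^sub>M density lborel c))"
    by (subst nn_integral_indicator[symmetric], simp, unfold convolution_def,
        subst nn_integral_distr) (auto simp: case_prod_beta)
  also have "\<dots> = (\<integral>\<^sup>+y. \<integral>\<^sup>+x. indicator A (y + x) \<partial>density lborel c \<partial>M)"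
    by (subst N.nn_integral_fst[symmetric]) auto
  also have "\<dots> = (\<integral>\<^sup>+y. \<integral>\<^sup>+x. c (x - y) * indicator A x \<partial>lborel \<partial>M)"
  proof (rule nn_integral_cong)
    fix y
    show "(\<integral>\<^sup>+x. indicator A (y + x) \<partial>density lborel c) = (\<integral>\<^sup>+x. c (x - y) * indicator A x \<partial>lborel)"
      by (subst nn_integral_density, simp, simp,
          subst (2) nn_integral_real_affine[where c = 1 and t = y]) auto
  qed
  also have "\<dots> = (\<integral>\<^sup>+x. \<integral>\<^sup>+y. c (x - y) * indicator A x \<partial>M \<partial>lborel)"
    by (rule P.Fubini') simp
  also have "\<dots> = (\<integral>\<^sup>+x. (\<integral>\<^sup>+y. c (x - y) \<partial>M) * indicator A x \<partial>lborel)"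
    by (intro nn_integral_cong nn_integral_multc) simp
  also have "\<dots> = emeasure (density lborel (\<lambda>x. \<integral>\<^sup>+y. c (x - y) \<partial>M)) A"
    by (subst emeasure_density) auto
  finally show "emeasure (M \<star> density lborel c) A
      = emeasure (density lborel (\<lambda>x. \<integral>\<^sup>+y. c (x - y) \<partial>M)) A" .
qed simp

lemma unimodal_density:
  fixes f :: "real \<Rightarrow> real"
  assumes [measurable]: "f \<in> borel_measurable borel"
    and "\<And>x. 0 \<le> f x" "mono_on {..a} f" "antimono_on {a..} f"
  shows "unimodal (density lborel (\<lambda>x. ennreal (f x)))"
  unfolding unimodal_def
proof (intro conjI exI ballI allI)
  show "mono_on {..<a} f" "antimono_on {a<..} f"
    using assms(3,4) by (auto intro: monotone_on_subset)
  \<comment> \<open>Points are Lebesgue null, so the atomic term in \<open>unimodal\<close>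
    vanishes.\<close>
  have "emeasure (density lborel (\<lambda>x. ennreal (f x))) {a} = 0"
    using AE_lborel_singleton[of a]
    by (subst emeasure_density) (auto simp: nn_integral_0_iff_AE indicator_def elim: AE_mp)
  then show "emeasure (density lborel (\<lambda>x. ennreal (f x))) A =
      emeasure (density lborel (\<lambda>x. ennreal (f x))) {a} * emeasure (return borel a) A
      + (\<integral>\<^sup>+x\<in>A. ennreal (f x) \<partial>lborel)" if "A \<in> sets borel" for A
    using that by (simp add: emeasure_density)
qed (use assms in auto)

lemma unimodal_return: "unimodal (return borel (a::real))"
  unfolding unimodal_def
  by (intro conjI exI[of _ a] exI[of _ "\<lambda>_. 0"]) (auto simp: monotone_on_def)

lemma convolution_return_0:
  fixes M :: "real measure"
  assumes "finite_measure M" "sets M = sets borel"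
  shows "M \<star> return borel 0 = M"
proof (rule measure_eqI)
  interpret finite_measure M by fact
  interpret R: prob_space "return borel (0::real)"
    by (rule prob_space_return) simp
  fix A assume "A \<in> sets (M \<star> return borel 0)"
  then have A: "A \<in> sets borel"
    by simp
  have "emeasure (M \<star> return borel 0) A = (\<integral>\<^sup>+x. emeasure (return borel 0) {b. b + x \<in> A} \<partial>M)"
    using A assms by (intro convolution_emeasure) (auto simp: R.finite_measure_axioms sets_eq_imp_space_eq)
  also have "\<dots> = (\<integral>\<^sup>+x. indicator A x \<partial>M)"
  proof (rule nn_integral_cong)
    fix x
    have "{b. b + x \<in> A} \<in> sets borel"
      using A by measurable
    then show "emeasure (return borel 0) {b. b + x \<in> A} = indicator A x"
      by (simp add: indicator_def)
  qed
  also have "\<dots> = emeasure M A"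
    using A assms by simp
  finally show "emeasure (M \<star> return borel 0) A = emeasure M A" .
qed (use assms in simp)

text \<open>A nonnegative function with zero integral vanishes almost everywhere, so all mass sits
  at 0. This settles t = 0, which forces a zero third moment.\<close>

lemma (in real_distribution) eq_return_0_if_moment_eq_0:
  assumes "integrable M (\<lambda>x. \<bar>x\<bar> ^ 3)" "(\<integral>x. \<bar>x\<bar> ^ 3 \<partial>M) = 0"
  shows "M = return borel 0"
proof (rule measure_eqI)
  have ae: "AE x in M. x = 0"
    using assms by (subst (asm) integral_nonneg_eq_0_iff_AE) auto
  fix A assume A: "A \<in> sets M"
  have "emeasure M A = (\<integral>\<^sup>+x. indicator A x \<partial>M)"
    using A by simp
  also have "\<dots> = (\<integral>\<^sup>+x. indicator A 0 \<partial>M)"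
    using ae by (intro nn_integral_cong_AE) auto
  also have "\<dots> = emeasure (return borel 0) A"
    using A emeasure_space_1 by simp
  finally show "emeasure M A = emeasure (return borel 0) A" .
qed simp

section \<open>The degenerate case t = 0 and rescaling for t > 0\<close>

theorem theorem5p2:
  fixes \<mu> :: "real measure" and \<beta> t :: real
  assumes "real_distribution \<mu>"
    and "integrable \<mu> (\<lambda>x. \<bar>x\<bar> ^ 3)"
    and "\<beta> = (\<integral>x. \<bar>x\<bar> ^ 3 \<partial>\<mu>)"
    and "t \<ge> 20 * root 3 \<beta>"
  shows "unimodal (\<mu> \<star> cauchy_distribution t)"
proof -
  interpret real_distribution \<mu> by fact
  have beta: "0 \<le> \<beta>"
    unfolding assms(3) by (rule Bochner_Integration.integral_nonneg) simp
  then have root: "0 \<le> root 3 \<beta>"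
    by simp
  show ?thesis
  proof (cases "t = 0")
    case True
    with assms(4) root have "root 3 \<beta> = 0"
      by linarith
    then have "\<mu> = return borel 0"
      using assms(2,3) by (intro eq_return_0_if_moment_eq_0) auto
    moreover have "\<mu> \<star> return borel 0 = \<mu>"
      by (intro convolution_return_0 finite_measure_axioms) simp
    ultimately show ?thesis
      using True unimodal_return[of 0] by (simp add: cauchy_distribution_def)
  next
    case False
    with assms(4) root have t: "0 < t"
      by linarith
    define G where "G u = expectation (\<lambda>y. kern (u - y / t))" for u
    \<comment> \<open>The density of C_t at x - y is \<open>kern\<close> ((x - y) / t) / (pi t);
      integrating over y shows \<open>f\<close> to be the density of the convolution.\<close>
    define f where "f x = 1 / (pi * t) * G (x / t)" for x
    have [measurable]: "kern \<in> borel_measurable borel"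
      by (intro borel_measurable_continuous_onI continuous_kern)
    have scaled: "\<bar>y / t\<bar> ^ 3 = \<bar>y\<bar> ^ 3 / t ^ 3" for y
      using t by (simp add: power_divide)
    \<comment> \<open>Cubing the hypothesis on \<open>t\<close> gives the scaled moment bound: 8000
      is the cube of 20.\<close>
    have "8000 * \<beta> = (20 * root 3 \<beta>) ^ 3"
      using beta by (simp add: power_mult_distrib real_root_pow_pos2)
    also have "\<dots> \<le> t ^ 3"
      using assms(4) root by (intro power_mono) auto
    finally have "expectation (\<lambda>y. \<bar>y / t\<bar> ^ 3) \<le> 1/8000"
      using t by (simp only: scaled) (simp add: assms(3) divide_le_eq)
    moreover have "integrable \<mu> (\<lambda>y. \<bar>y / t\<bar> ^ 3)"
      unfolding scaled using assms(2) by simp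
    ultimately obtain a where a: "mono_on {..a} G" "antimono_on {a..} G"
      using expectation_kern_unimodal[of "\<lambda>y. y / t"] unfolding G_def by auto
    have "G \<in> borel_measurable borel"
      unfolding G_def by measurable
    then have f_meas: "f \<in> borel_measurable borel"
      unfolding f_def by measurable
    have "unimodal (density lborel (\<lambda>x. ennreal (f x)))"
    \<comment> \<open>Undoing the scaling moves the mode from \<open>a\<close> to
      \<open>a * t\<close>; monotonicity survives because t > 0.\<close>
    proof (rule unimodal_density[where a = "a * t"])
      show "0 \<le> f x" for x
        unfolding f_def G_def using t kern_nonneg
        by (intro mult_nonneg_nonneg Bochner_Integration.integral_nonneg) auto
      show "mono_on {..a * t} f"
        unfolding f_def using t
        by (intro mono_onI mult_left_mono mono_onD[OF a(1)]) (auto simp: field_simps)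
      show "antimono_on {a * t..} f"
        unfolding f_def using t
        by (intro monotone_onI mult_left_mono monotone_onD[OF a(2)]) (auto simp: field_simps)
    qed fact
    also have "density lborel (\<lambda>x. ennreal (f x)) = (\<mu> \<star> cauchy_distribution t)"
    proof -
      have kern_eq: "t / (pi * (x\<^sup>2 + t\<^sup>2)) = 1 / (pi * t) * kern (x / t)" for x
      proof -
        have "x\<^sup>2 + t\<^sup>2 = t\<^sup>2 * (1 + (x / t)\<^sup>2)"
          using t by (simp add: field_simps)
        then show ?thesis
          using t by (simp add: kern_def power2_eq_square)
      qed
      have "(\<integral>\<^sup>+y. ennreal (1 / (pi * t) * kern ((x - y) / t)) \<partial>\<mu>) = ennreal (f x)" for x
      proof -
        have "integrable \<mu> (\<lambda>y. kern (x / t - y / t))"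
          using abs_kern_le_1 by (intro integrable_const_bound[where B = 1]) auto
        then show ?thesis
          unfolding f_def G_def diff_divide_distrib using t kern_nonneg
          by (subst nn_integral_eq_integral) auto
      qed
      then show ?thesis
        using False unfolding cauchy_distribution_def kern_eq
        by (subst if_not_P, simp, subst convolution_density_lborel)
           (auto simp: finite_measure_axioms)
    qed
    finally show ?thesis .
  qed
qed

end
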